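(* Fix an integer $k\geq 4$. Then, as $r\to\infty$ (over integers $r\geq 2$), \[ w_r(k)\geq \left(\frac{3-e}{2}\right)\frac{(r(k-2))!}{((k-2)!)^r}\left(1-o_{r\to\infty}(1)\right). \]
   Context: For each integer $r\geq 2$, $w_r:\mathbb{Z}_{\geq 2}^r\to\mathbb{Z}_{\geq 0}$ denotes the family of functions uniquely determined by: (i) $w_2(k_1,k_2)=0$ for $k_1,k_2\geq 2$; (ii) for $r\geq 2$ and $k_1,\dots,k_r\geq 2$, inserting a coordinate equal to $2$ at any position of $(k_1,\dots,k_r)$ gives an $(r+1)$-tuple at which $w_{r+1}$ equals $w_r(k_1,\dots,k_r)$; (iii) for $k_1,\dots,k_r\geq 3$, $w_r(k_1,\dots,k_r)=\sum_{i=1}^r w_r(k_1,\dots,k_i-1,\dots,k_r)+(r-2)$ (the $i$-th coordinate decreased by $1$). $w_r(k)$ means $w_r(k,\dots,k)$. $o_{r\to\infty}(1)$ denotes a quantity tending to $0$ as $r\to\infty$. *)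

theory Defs
  imports Complex_Main
begin

text \<open>
  The whole family of functions \<open>w\<^sub>r\<close> is represented by a single function \<open>w\<close> on lists:
  \<open>w\<^sub>r(k\<^sub>1, \<dots>, k\<^sub>r)\<close> is \<open>w [k\<^sub>1, \<dots>, k\<^sub>r]\<close>, so \<open>r\<close> is the length of the argument.
  Only lists of length at least 2 with all entries at least 2 are in the domain of the family;
  the three clauses say nothing about the values of \<open>w\<close> on other lists.
\<close>

definition w_family :: "(nat list \<Rightarrow> nat) \<Rightarrow> bool" where
  "w_family w \<longleftrightarrow>
    (\<forall>k\<^sub>1 k\<^sub>2. k\<^sub>1 \<ge> 2 \<and> k\<^sub>2 \<ge> 2 \<longrightarrow> w [k\<^sub>1, k\<^sub>2] = 0) \<and>
    (\<forall>xs ys. length (xs @ ys) \<ge> 2 \<and> (\<forall>k \<in> set (xs @ ys). k \<ge> 2) \<longrightarrow>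
       w (xs @ 2 # ys) = w (xs @ ys)) \<and>
    (\<forall>ks. length ks \<ge> 2 \<and> (\<forall>k \<in> set ks. k \<ge> 3) \<longrightarrow>
       w ks = (\<Sum>i<length ks. w (ks[i := ks ! i - 1])) + (length ks - 2))"

text \<open>The three clauses determine the family: uniqueness on the domain, and existence.\<close>

lemma sum_list_decr_less:
  fixes ks :: "nat list"
  assumes "i < length ks" "ks ! i \<ge> 1"
  shows "sum_list (ks[i := ks ! i - 1]) < sum_list ks"
proof -
  have "ks ! i \<le> sum_list ks"
    using assms(1) by (simp add: elem_le_sum_list)
  then show ?thesis
    using assms by (simp add: sum_list_update)
qed

lemma w_family_unique:
  assumes v: "w_family v" and w: "w_family w"
    and "length ks \<ge> 2" "\<forall>k \<in> set ks. k \<ge> 2"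
  shows "v ks = w ks"
  using assms(3,4)
proof (induction "sum_list ks" arbitrary: ks rule: less_induct)
  case less
  consider (two) "length ks = 2" | (ins) "length ks > 2" "2 \<in> set ks"
    | (dec) "length ks > 2" "2 \<notin> set ks"
    using less.prems(1) by linarith
  then show ?case
  proof cases
    case two
    then obtain a b where "ks = [a, b]"
      by (auto simp: numeral_2_eq_2 length_Suc_conv)
    then show ?thesis
      using v w less.prems by (simp add: w_family_def)
  next
    case ins
    then obtain xs ys where ks: "ks = xs @ 2 # ys"
      by (meson split_list)
    have d: "length (xs @ ys) \<ge> 2" "\<forall>k \<in> set (xs @ ys). k \<ge> 2"
      using ins less.prems ks by auto
    have "v (xs @ ys) = w (xs @ ys)"
      by (rule less.hyps) (use d ks in auto)
    moreover have "v ks = v (xs @ ys)" "w ks = w (xs @ ys)"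
      using v w d unfolding w_family_def ks by blast+
    ultimately show ?thesis by simp
  next
    case dec
    have ge3: "\<forall>k \<in> set ks. k \<ge> 3"
    proof
      fix k assume "k \<in> set ks"
      then have "k \<ge> 2" "k \<noteq> 2" using less.prems dec by auto
      then show "k \<ge> 3" by simp
    qed
    have "v (ks[i := ks ! i - 1]) = w (ks[i := ks ! i - 1])" if i: "i < length ks" for i
    proof (rule less.hyps)
      have "ks ! i \<ge> 3" using ge3 i by simp
      then show "sum_list (ks[i := ks ! i - 1]) < sum_list ks"
        using i by (intro sum_list_decr_less) auto
      show "\<forall>k \<in> set (ks[i := ks ! i - 1]). k \<ge> 2"
      proof
        fix k assume "k \<in> set (ks[i := ks ! i - 1])"
        then have "k = ks ! i - 1 \<or> k \<in> set ks"
          using set_update_subset_insert by fastforce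
        then show "k \<ge> 2" using \<open>ks ! i \<ge> 3\<close> less.prems by auto
      qed
    qed (use less.prems in simp)
    then have eq: "(\<Sum>i<length ks. v (ks[i := ks ! i - 1])) = (\<Sum>i<length ks. w (ks[i := ks ! i - 1]))"
      by simp
    have "v ks = (\<Sum>i<length ks. v (ks[i := ks ! i - 1])) + (length ks - 2)"
         "w ks = (\<Sum>i<length ks. w (ks[i := ks ! i - 1])) + (length ks - 2)"
      using v w ge3 less.prems(1) unfolding w_family_def by blast+
    with eq show ?thesis by simp
  qed
qed

function w_rec :: "nat list \<Rightarrow> nat" where
  "w_rec ks = (let ys = filter (\<lambda>k. 3 \<le> k) ks in
     if length ys \<le> 2 then 0
     else (\<Sum>i<length ys. w_rec (ys[i := ys ! i - 1])) + (length ys - 2))"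
  by pat_completeness auto
termination
proof (relation "measure sum_list", simp)
  fix ks ys :: "nat list" and i
  assume ys: "ys = filter (\<lambda>k. 3 \<le> k) ks" and i: "i \<in> {..<length ys}"
  have "ys ! i \<in> set ys" using i by simp
  then have "ys ! i \<ge> 3" using ys by auto
  then have "sum_list (ys[i := ys ! i - 1]) < sum_list ys"
    using i by (intro sum_list_decr_less) auto
  also have "sum_list ys \<le> sum_list ks"
    unfolding ys by (induction ks) auto
  finally show "(ys[i := ys ! i - 1], ks) \<in> measure sum_list" by simp
qed

declare w_rec.simps [simp del]

lemma w_rec_short: "length ks \<le> 2 \<Longrightarrow> w_rec ks = 0"
  by (subst w_rec.simps) (simp add: Let_def order.trans[OF length_filter_le])

lemma w_family_w_rec: "w_family w_rec"
  unfolding w_family_def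
proof (intro conjI allI impI)
  show "w_rec [k\<^sub>1, k\<^sub>2] = 0" for k\<^sub>1 k\<^sub>2
    by (simp add: w_rec_short)
  show "w_rec (xs @ 2 # ys) = w_rec (xs @ ys)" for xs ys
    by (subst (1 2) w_rec.simps) simp
  fix ks :: "nat list"
  assume ks: "length ks \<ge> 2 \<and> (\<forall>k \<in> set ks. k \<ge> 3)"
  then have f: "filter (\<lambda>k. 3 \<le> k) ks = ks" by simp
  show "w_rec ks = (\<Sum>i<length ks. w_rec (ks[i := ks ! i - 1])) + (length ks - 2)"
  proof (cases "length ks \<le> 2")
    case True
    then show ?thesis by (simp add: w_rec_short)
  next
    case False
    then show ?thesis by (subst w_rec.simps) (simp add: f Let_def)
  qed
qed

end

theory Submission
  imports Defs "HOL-Real_Asymp.Real_Asymp"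
begin

text \<open>
  Put \<open>m\<^sub>i = k\<^sub>i - 2\<close> and \<open>n = \<Sum>m\<^sub>i\<close>. Unfolding the recursion, \<open>w\<close> counts the lattice paths descending
  from \<open>m\<close>, each weighted by the support size of its endpoint minus 2. It suffices to keep the
  endpoints that are the indicator of a 3-set. Up to the factor \<open>3!\<close> those paths are the words
  with letter multiplicities \<open>m\<close> whose last three letters are distinct, and there are
  \<open>(n-3)! \<cdot> 6e\<^sub>3(m) / \<Prod>m\<^sub>i!\<close> of these, \<open>e\<^sub>3\<close> being the elementary symmetric polynomial. For constant
  \<open>m\<close> and \<open>r \<rightarrow> \<infinity>\<close> this is asymptotically the number of all words, so \<open>w\<close> is asymptotically at
  least \<open>1/6\<close> of the multinomial coefficient, and \<open>1/6 \<ge> (3-e)/2\<close> because \<open>e \<ge> 8/3\<close>.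
\<close>

definition power_sum :: "nat \<Rightarrow> nat list \<Rightarrow> real" where
  "power_sum j ms = (\<Sum>m\<leftarrow>ms. real m ^ j)"

text \<open>Newton's identity for \<open>6e\<^sub>3\<close>.\<close>

definition six_e3 :: "nat list \<Rightarrow> real" where
  "six_e3 ms = power_sum 1 ms ^ 3 - 3 * power_sum 1 ms * power_sum 2 ms + 2 * power_sum 3 ms"

definition prod_fact :: "nat list \<Rightarrow> real" where
  "prod_fact ms = (\<Prod>m\<leftarrow>ms. fact m)"

text \<open>The truncated subtraction is harmless: if the entries sum to less than 3, at most two
  are nonzero and \<open>six_e3\<close> vanishes.\<close>

definition words_distinct_end :: "nat list \<Rightarrow> real" where
  "words_distinct_end ms = fact (sum_list ms - 3) / prod_fact ms * six_e3 ms"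

lemma power_sum_Cons: "power_sum j (m # ms) = real m ^ j + power_sum j ms"
  by (simp add: power_sum_def)

lemma power_sum_1: "power_sum 1 ms = real (sum_list ms)"
  by (induction ms) (simp_all add: power_sum_def)

lemma power_sum_conv_sum: "power_sum j ms = (\<Sum>i<length ms. real (ms ! i) ^ j)"
  by (simp add: power_sum_def sum_list_sum_nth atLeast0LessThan)

lemma power_sum_decr:
  assumes "i < length ms" "ms ! i \<ge> 1"
  shows "power_sum j (ms[i := ms ! i - 1]) = power_sum j ms - real (ms ! i) ^ j + (real (ms ! i) - 1) ^ j"
  using assms
proof (induction ms arbitrary: i)
  case (Cons m ms)
  then show ?case by (cases i) (simp_all add: power_sum_Cons of_nat_diff)
qed simp

lemma prod_fact_decr:
  assumes "i < length ms" "ms ! i \<ge> 1"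
  shows "prod_fact ms = real (ms ! i) * prod_fact (ms[i := ms ! i - 1])"
  using assms
proof (induction ms arbitrary: i)
  case (Cons m ms)
  then show ?case
    by (cases i) (simp_all add: prod_fact_def fact_reduce[of m])
qed simp

lemma sum_list_decr:
  fixes ms :: "nat list"
  assumes "i < length ms" "ms ! i \<ge> 1"
  shows "sum_list (ms[i := ms ! i - 1]) = sum_list ms - 1"
  using assms elem_le_sum_list[of i ms] by (simp add: sum_list_update)

text \<open>Lowering m_i by 1 lowers e_3 by the e_2 of the other entries; weighted by m_i, these
  losses add up to 3 e_3.\<close>

lemma sum_six_e3_decr:
  assumes pos: "\<forall>m \<in> set ms. m \<ge> 1"
  shows "(\<Sum>i<length ms. real (ms ! i) * six_e3 (ms[i := ms ! i - 1])) =
    (real (sum_list ms) - 3) * six_e3 ms"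
proof -
  define p where "p j = power_sum j ms" for j
  define x where "x i = real (ms ! i)" for i
  have psum: "(\<Sum>i<length ms. x i ^ j) = p j" for j
    by (simp add: x_def p_def power_sum_conv_sum)
  \<comment> \<open>A cubic in \<open>x i\<close> with coefficients independent of \<open>i\<close>
    and no constant term; the exponent 1 is kept so that \<open>psum\<close> applies to every
    power.\<close>
  have "x i * six_e3 (ms[i := ms ! i - 1]) =
      (p 1 ^ 3 - 3 * p 1 ^ 2 + 3 * p 1 - 1 - 3 * (p 1 - 1) * (p 2 + 1) + 2 * p 3 - 2) * x i ^ 1
      + (6 * (p 1 - 1) + 6) * x i ^ 2 - 6 * x i ^ 3"
    if i: "i < length ms" for i
  proof -
    have i1: "ms ! i \<ge> 1" using pos i by simp
    show ?thesis
      unfolding six_e3_def power_sum_decr[OF i i1] p_def[symmetric] x_def[symmetric]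
      by (simp add: algebra_simps power2_eq_square power3_eq_cube)
  qed
  then have "(\<Sum>i<length ms. x i * six_e3 (ms[i := ms ! i - 1])) =
      (\<Sum>i<length ms. (p 1 ^ 3 - 3 * p 1 ^ 2 + 3 * p 1 - 1 - 3 * (p 1 - 1) * (p 2 + 1) + 2 * p 3 - 2) * x i ^ 1
      + (6 * (p 1 - 1) + 6) * x i ^ 2 - 6 * x i ^ 3)"
    by (intro sum.cong) auto
  also have "\<dots> = (p 1 ^ 3 - 3 * p 1 ^ 2 + 3 * p 1 - 1 - 3 * (p 1 - 1) * (p 2 + 1) + 2 * p 3 - 2) * p 1
      + (6 * (p 1 - 1) + 6) * p 2 - 6 * p 3"
    unfolding sum_subtractf sum.distrib sum_distrib_left[symmetric] psum ..
  also have "\<dots> = (p 1 - 3) * six_e3 ms"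
    unfolding six_e3_def p_def[symmetric]
    by (simp add: algebra_simps power2_eq_square power3_eq_cube)
  finally show ?thesis
    by (simp only: x_def p_def power_sum_1)
qed

text \<open>Sort the words by their first letter. Deleting it leaves the last three letters intact
  as long as the word has more than three.\<close>

lemma words_distinct_end_rec:
  assumes pos: "\<forall>m \<in> set ms. m \<ge> 1" and n: "sum_list ms > 3"
  shows "words_distinct_end ms = (\<Sum>i<length ms. words_distinct_end (ms[i := ms ! i - 1]))"
proof -
  \<comment> \<open>With this shift, (n+1)! belongs to \<open>ms\<close> and n! to each lowered
    list; the quotient n+1 is the factor \<open>sum_list ms - 3\<close> from
    \<open>sum_six_e3_decr\<close>.\<close>
  obtain n where n: "sum_list ms = n + 4"
    using n that[of "sum_list ms - 4"] by simp
  have "words_distinct_end (ms[i := ms ! i - 1]) =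
      fact n / prod_fact ms * (real (ms ! i) * six_e3 (ms[i := ms ! i - 1]))"
    if i: "i < length ms" for i
  proof -
    have i1: "ms ! i \<ge> 1" using pos i by simp
    show ?thesis
      unfolding words_distinct_end_def sum_list_decr[OF i i1] prod_fact_decr[OF i i1] n
      using i1 by simp
  qed
  then have "(\<Sum>i<length ms. words_distinct_end (ms[i := ms ! i - 1])) =
      (\<Sum>i<length ms. fact n / prod_fact ms * (real (ms ! i) * six_e3 (ms[i := ms ! i - 1])))"
    by (intro sum.cong) auto
  also have "\<dots> = fact n / prod_fact ms * ((real (sum_list ms) - 3) * six_e3 ms)"
    unfolding sum_distrib_left[symmetric] sum_six_e3_decr[OF pos] ..
  also have "\<dots> = words_distinct_end ms"
    by (simp add: words_distinct_end_def n algebra_simps add_divide_distrib)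
  finally show ?thesis ..
qed

text \<open>A letter of multiplicity 0 occurs in no word. This mirrors the clause of
  \<open>w_family\<close> that inserts a 2.\<close>

lemma words_distinct_end_insert_0: "words_distinct_end (xs @ 0 # ys) = words_distinct_end (xs @ ys)"
  by (simp add: words_distinct_end_def six_e3_def prod_fact_def power_sum_def)

lemma words_distinct_end_pair: "words_distinct_end [a, b] = 0"
  by (simp add: words_distinct_end_def six_e3_def power_sum_def algebra_simps
      power2_eq_square power3_eq_cube)

text \<open>The induction follows the clauses of \<open>w_family\<close>. Its measure includes the
  length because deleting a 0 leaves the sum unchanged.\<close>

lemma words_distinct_end_le_w:
  assumes w: "w_family w" and "length ms \<ge> 2"
  shows "words_distinct_end ms \<le> 6 * real (w (map (\<lambda>m. m + 2) ms))"
  using assms(2)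
proof (induction "sum_list ms + length ms" arbitrary: ms rule: less_induct)
  case less
  consider (two) "length ms = 2" | (zero) "length ms > 2" "0 \<in> set ms"
    | (pos) "length ms > 2" "0 \<notin> set ms"
    using less.prems by linarith
  then show ?case
  proof cases
    case two
    then obtain a b where "ms = [a, b]"
      by (auto simp: numeral_2_eq_2 length_Suc_conv)
    then show ?thesis by (simp add: words_distinct_end_pair)
  next
    case zero
    then obtain xs ys where ms: "ms = xs @ 0 # ys"
      by (meson split_list)
    have "words_distinct_end (xs @ ys) \<le> 6 * real (w (map (\<lambda>m. m + 2) (xs @ ys)))"
      by (rule less.hyps) (use zero ms in auto)
    moreover have "length (map (\<lambda>m. m + 2) xs @ map (\<lambda>m. m + 2) ys) \<ge> 2"
        "\<forall>k \<in> set (map (\<lambda>m. m + 2) xs @ map (\<lambda>m. m + 2) ys). k \<ge> 2"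
      using zero(1) ms by auto
    then have "w (map (\<lambda>m. m + 2) xs @ 2 # map (\<lambda>m. m + 2) ys) =
        w (map (\<lambda>m. m + 2) xs @ map (\<lambda>m. m + 2) ys)"
      using w unfolding w_family_def by blast
    ultimately show ?thesis by (simp add: ms words_distinct_end_insert_0 numeral_2_eq_2)
  next
    case pos
    have ge1: "\<forall>m \<in> set ms. m \<ge> 1"
      using pos(2) by (metis One_nat_def Suc_leI neq0_conv)
    have upd: "(map (\<lambda>m. m + 2) ms)[i := map (\<lambda>m. m + 2) ms ! i - 1] =
        map (\<lambda>m. m + 2) (ms[i := ms ! i - 1])" if "i < length ms" for i
    proof -
      have "ms ! i \<ge> 1" using ge1 that by simp
      then show ?thesis using that by (simp add: map_update)
    qed
    have "w (map (\<lambda>m. m + 2) ms) = (\<Sum>i<length (map (\<lambda>m. m + 2) ms).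
        w ((map (\<lambda>m. m + 2) ms)[i := map (\<lambda>m. m + 2) ms ! i - 1])) + (length (map (\<lambda>m. m + 2) ms) - 2)"
      using w pos(1) ge1 unfolding w_family_def by (auto simp: Suc_le_eq)
    then have rec: "w (map (\<lambda>m. m + 2) ms) =
        (\<Sum>i<length ms. w (map (\<lambda>m. m + 2) (ms[i := ms ! i - 1]))) + (length ms - 2)"
      using upd by simp
    have len: "length ms \<le> sum_list ms"
      using ge1 by (induction ms) auto
    show ?thesis
    proof (cases "sum_list ms = 3")
      \<comment> \<open>Three or more positive entries with sum 3 can only be
        \<open>[1, 1, 1]\<close>. Its 6 words account for the factor 6, and the additive term of the
        recursion is used only here.\<close>
      case True
      then obtain a b c where "ms = [a, b, c]"
        using pos(1) len by (auto simp: numeral_eq_Suc Suc_le_eq le_Suc_eq length_Suc_conv)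
      with True ge1 have "ms = [1, 1, 1]" by auto
      then have "words_distinct_end ms = 6"
        by (simp add: words_distinct_end_def six_e3_def power_sum_def prod_fact_def)
      moreover have "w (map (\<lambda>m. m + 2) ms) \<ge> 1"
        using rec pos(1) by linarith
      ultimately show ?thesis by simp
    next
      case False
      then have "sum_list ms > 3" using pos(1) len by linarith
      then have "words_distinct_end ms = (\<Sum>i<length ms. words_distinct_end (ms[i := ms ! i - 1]))"
        by (rule words_distinct_end_rec[OF ge1])
      also have "\<dots> \<le> (\<Sum>i<length ms. 6 * real (w (map (\<lambda>m. m + 2) (ms[i := ms ! i - 1]))))"
      proof (rule sum_mono)
        fix i assume "i \<in> {..<length ms}"
        then have i: "i < length ms" by simp
        show "words_distinct_end (ms[i := ms ! i - 1]) \<le> 6 * real (w (map (\<lambda>m. m + 2) (ms[i := ms ! i - 1])))"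
          by (rule less.hyps) (use i ge1 less.prems sum_list_decr_less[of i ms] in auto)
      qed
      \<comment> \<open>The additive term \<open>length ms - 2\<close> is discarded.\<close>
      also have "\<dots> \<le> 6 * real (w (map (\<lambda>m. m + 2) ms))"
        unfolding rec by (simp add: sum_distrib_left)
      finally show ?thesis .
    qed
  qed
qed

text \<open>The last fraction is the probability that a random word ends in three distinct letters:
  given the last letter, d(r-1) of the remaining rd-1 positions of the multiset differ from it, then
  d(r-2) of rd-2 differ from both.\<close>

lemma words_distinct_end_replicate:
  fixes r d :: nat
  assumes "r \<ge> 2" "d \<ge> 2"
  shows "words_distinct_end (replicate r d) = fact (r * d) / fact d ^ r *
    (real d * (real r - 1) * (real d * (real r - 2)) / ((real r * real d - 1) * (real r * real d - 2)))"
proof -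
  have "r * d \<ge> 2 * 2" using assms by (intro mult_mono) auto
  then obtain n where n: "r * d = n + 3"
    using that[of "r * d - 3"] by simp
  then have nr: "real r * real d = real n + 3"
    by (metis of_nat_add of_nat_mult of_nat_numeral)
  have "six_e3 (replicate r d) = (real r * real d) * (real d * (real r - 1) * (real d * (real r - 2)))"
    by (simp add: six_e3_def power_sum_def sum_list_replicate algebra_simps
        power2_eq_square power3_eq_cube)
  moreover have "prod_fact (replicate r d) = fact d ^ r"
    by (induction r) (simp_all add: prod_fact_def)
  moreover have "fact (n + 3) = (real n + 3) * ((real n + 2) * (real n + 1)) * fact n"
    by (simp add: eval_nat_numeral algebra_simps)
  moreover have "sum_list (replicate r d) - 3 = n"
    using n by (simp add: sum_list_replicate)
  ultimately show ?thesis
    unfolding words_distinct_end_def n nr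
    by (simp add: divide_simps add.commute)
qed

text \<open>Already 1 + 1 + 1/2 + 1/6 = 8/3, and the later terms of the series are positive.\<close>

lemma exp_1_ge_8_3: "exp 1 \<ge> (8 / 3 :: real)"
proof -
  have "(\<Sum>i<4. inverse (fact i) * (1::real) ^ i) \<le> exp 1"
    unfolding exp_def real_scaleR_def[symmetric]
    by (intro sum_le_suminf summable_exp_generic) auto
  then show ?thesis by (simp add: eval_nat_numeral)
qed

theorem theorem3p8:
  fixes w :: "nat list \<Rightarrow> nat" and k :: nat
  assumes "w_family w" and "k \<ge> 4"
  shows "\<exists>\<epsilon> :: nat \<Rightarrow> real. \<epsilon> \<longlonglongrightarrow> 0 \<and>
           (\<forall>r \<ge> 2. real (w (replicate r k)) \<ge>
              (3 - exp 1) / 2 * (fact (r * (k - 2)) / (fact (k - 2)) ^ r) * (1 - \<epsilon> r))"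
proof -
  define d where "d = k - 2"
  have d: "d \<ge> 2" and k: "k = d + 2" using assms(2) by (auto simp: d_def)
  define \<rho> where "\<rho> r = real d * (real r - 1) * (real d * (real r - 2)) /
    ((real r * real d - 1) * (real r * real d - 2))" for r :: nat
  \<comment> \<open>\<open>\<rho>\<close> is the product of two such quotients, with a = 1 and a =
    2.\<close>
  have "(\<lambda>r. c * (real r - a) / (real r * c - a)) \<longlonglongrightarrow> 1" if "c > 0" for a c :: real
    using that by real_asymp
  from tendsto_mult[OF this[of "real d" 1] this[of "real d" 2]] have "\<rho> \<longlonglongrightarrow> 1"
    using d by (simp add: \<rho>_def[abs_def])
  \<comment> \<open>The error term is \<open>1 - \<rho> r\<close>.\<close>
  from tendsto_diff[OF tendsto_const[of 1] this] have "(\<lambda>r. 1 - \<rho> r) \<longlonglongrightarrow> 0"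
    by simp
  moreover have "(3 - exp 1) / 2 * (fact (r * (k - 2)) / fact (k - 2) ^ r) * (1 - (1 - \<rho> r)) \<le>
      real (w (replicate r k))" if r: "r \<ge> 2" for r
  proof -
    \<comment> \<open>Both denominators of \<open>\<rho> r\<close> are positive, so it is
      nonnegative and the comparison of (3-e)/2 with 1/6 may be multiplied by it.\<close>
    have "real r * real d \<ge> 2 * 2" using r d by (intro mult_mono) auto
    then have "\<rho> r \<ge> 0" using r by (simp add: \<rho>_def)
    then have nonneg: "fact (r * d) / fact d ^ r * \<rho> r \<ge> 0" by simp
    have "(3 - exp 1) / 2 * (fact (r * d) / fact d ^ r * \<rho> r) \<le>
        1 / 6 * (fact (r * d) / fact d ^ r * \<rho> r)"
      using exp_1_ge_8_3 nonneg by (intro mult_right_mono) auto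
    also have "\<dots> = 1 / 6 * words_distinct_end (replicate r d)"
      using words_distinct_end_replicate[OF r d] by (simp add: \<rho>_def)
    also have "\<dots> \<le> real (w (replicate r k))"
      using words_distinct_end_le_w[OF assms(1), of "replicate r d"] r by (simp add: k)
    finally show ?thesis by (simp add: k mult.assoc)
  qed
  ultimately show ?thesis by blast
qed

end
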